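(* Let $Q_m$, $T_m$, $\beta_m$ and $q_{m+1}$ come from $m$ steps of the Lanczos algorithm applied to the symmetric positive definite matrix $A\in\mathbb{R}^{d\times d}$, so that $AQ_m=Q_mT_m+\beta_m q_{m+1}e_m^{\top}$, and choose the complement basis $Q_{m,\perp}$ so that its first column is $q_{m+1}$. Then the off-diagonal block of $A$ in the basis $[\,Q_m\ \ Q_{m,\perp}\,]$ has rank at most one and is given by $$A_{m,\times}:=Q_m^{\top}AQ_{m,\perp}=\beta_m\,e_m e_1^{\top},$$ where $e_m\in\mathbb{R}^m$ is the last coordinate vector of $\mathbb{R}^m$ and $e_1\in\mathbb{R}^{d-m}$ is the first coordinate vector of $\mathbb{R}^{d-m}$. Moreover $\|A_{m,\times}\|_2=\beta_m$, and $\mathrm{range}(Q_m)$ is an exact invariant subspace of $A$ (i.e. $A_{m,\times}=0$) if and only if $\beta_m=0$.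
   Context: $A\in\mathbb{R}^{d\times d}$ is symmetric positive definite and $1\le m<d$. Starting from a unit vector $q_1=v_{\mathrm{ref}}/\|v_{\mathrm{ref}}\|_2$, $m$ steps of the Lanczos algorithm (exact arithmetic, no breakdown before step $m$) produce $Q_m=[q_1,\dots,q_m]\in\mathbb{R}^{d\times m}$ with orthonormal columns spanning the Krylov subspace $\mathrm{span}\{v_{\mathrm{ref}},Av_{\mathrm{ref}},\dots,A^{m-1}v_{\mathrm{ref}}\}$, a symmetric tridiagonal matrix $T_m=Q_m^{\top}AQ_m\in\mathbb{R}^{m\times m}$, a scalar $\beta_m\ge 0$, and a unit vector $q_{m+1}$ orthogonal to $\mathrm{range}(Q_m)$ (any such unit vector if $\beta_m=0$) with $AQ_m=Q_mT_m+\beta_mq_{m+1}e_m^{\top}$. $Q_{m,\perp}\in\mathbb{R}^{d\times(d-m)}$ has orthonormal columns spanning the orthogonal complement of $\mathrm{range}(Q_m)$, so $[\,Q_m\ \ Q_{m,\perp}\,]$ is orthogonal. *)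

theory Defs
  imports Complex_Main "Jordan_Normal_Form.DL_Rank"
begin

definition norm2 :: "real vec \<Rightarrow> real" where
  "norm2 x = sqrt (x \<bullet> x)"

text \<open>The supremum runs over the closed unit ball rather than the unit sphere, so that the set is
  nonempty also for a matrix without columns.\<close>

definition spectral_norm :: "real mat \<Rightarrow> real" where
  "spectral_norm M = (SUP x \<in> {x \<in> carrier_vec (dim_col M). norm2 x \<le> 1}. norm2 (M *\<^sub>v x))"

definition sym_pos_def :: "nat \<Rightarrow> real mat \<Rightarrow> bool" where
  "sym_pos_def d A \<longleftrightarrow> A \<in> carrier_mat d d \<and> transpose_mat A = A \<and>
     (\<forall>x \<in> carrier_vec d. x \<noteq> 0\<^sub>v d \<longrightarrow> x \<bullet> (A *\<^sub>v x) > 0)"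

definition outer_prod :: "real vec \<Rightarrow> real vec \<Rightarrow> real mat" where
  "outer_prod u w = mat (dim_vec u) (dim_vec w) (\<lambda>(i, j). u $ i * w $ j)"

definition orthonormal_cols :: "real mat \<Rightarrow> bool" where
  "orthonormal_cols Q \<longleftrightarrow> transpose_mat Q * Q = 1\<^sub>m (dim_col Q)"

definition range_mat :: "real mat \<Rightarrow> real vec set" where
  "range_mat M = vec_space.col_space (dim_row M) M"

definition invariant_subspace :: "real mat \<Rightarrow> real vec set \<Rightarrow> bool" where
  "invariant_subspace A W \<longleftrightarrow> (\<forall>x \<in> W. A *\<^sub>v x \<in> W)"

text \<open>The Lanczos iteration with starting vector \<open>v\<close>.  Indices are those of the usual
  presentation: the basis vectors are \<open>q\<^sub>1, q\<^sub>2, \<dots>\<close>, and \<open>q\<^sub>0 = 0\<close>, \<open>\<beta>\<^sub>0 = 0\<close> are conventions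
  making the three-term recurrence uniform:
  \<open>r\<^sub>k = A q\<^sub>k - \<alpha>\<^sub>k q\<^sub>k - \<beta>\<^sub>k\<^sub>-\<^sub>1 q\<^sub>k\<^sub>-\<^sub>1\<close> with \<open>\<alpha>\<^sub>k = q\<^sub>k \<bullet> A q\<^sub>k\<close>, then \<open>\<beta>\<^sub>k\<close> is the norm of \<open>r\<^sub>k\<close>
  and \<open>q\<^sub>k\<^sub>+\<^sub>1 = r\<^sub>k / \<beta>\<^sub>k\<close>.  If \<open>\<beta>\<^sub>k = 0\<close> (breakdown) the value given to \<open>q\<^sub>k\<^sub>+\<^sub>1\<close> here is the
  meaningless zero vector; see \<open>lanczos_next\<close> below.\<close>

function (sequential)
  lanczos_q :: "real mat \<Rightarrow> real vec \<Rightarrow> nat \<Rightarrow> real vec" and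
  lanczos_residual :: "real mat \<Rightarrow> real vec \<Rightarrow> nat \<Rightarrow> real vec" and
  lanczos_beta :: "real mat \<Rightarrow> real vec \<Rightarrow> nat \<Rightarrow> real"
where
  "lanczos_q A v 0 = 0\<^sub>v (dim_row A)"
| "lanczos_q A v (Suc 0) = (1 / norm2 v) \<cdot>\<^sub>v v"
| "lanczos_q A v (Suc (Suc k)) = (1 / lanczos_beta A v (Suc k)) \<cdot>\<^sub>v lanczos_residual A v (Suc k)"
| "lanczos_residual A v 0 = 0\<^sub>v (dim_row A)"
| "lanczos_residual A v (Suc k) =
     A *\<^sub>v lanczos_q A v (Suc k)
     - (lanczos_q A v (Suc k) \<bullet> (A *\<^sub>v lanczos_q A v (Suc k))) \<cdot>\<^sub>v lanczos_q A v (Suc k)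
     - lanczos_beta A v k \<cdot>\<^sub>v lanczos_q A v k"
| "lanczos_beta A v k = norm2 (lanczos_residual A v k)"
  by pat_completeness auto
termination
  by (relation "measure (case_sum (\<lambda>(A, v, k). 3 * k)
        (case_sum (\<lambda>(A, v, k). 3 * k + 1) (\<lambda>(A, v, k). 3 * k + 2)))") auto

definition lanczos_alpha :: "real mat \<Rightarrow> real vec \<Rightarrow> nat \<Rightarrow> real" where
  "lanczos_alpha A v k = lanczos_q A v k \<bullet> (A *\<^sub>v lanczos_q A v k)"

definition lanczos_no_breakdown :: "real mat \<Rightarrow> real vec \<Rightarrow> nat \<Rightarrow> bool" where
  "lanczos_no_breakdown A v m \<longleftrightarrow> (\<forall>k. 1 \<le> k \<and> k < m \<longrightarrow> lanczos_beta A v k \<noteq> 0)"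

definition lanczos_Q :: "real mat \<Rightarrow> real vec \<Rightarrow> nat \<Rightarrow> real mat" where
  "lanczos_Q A v m = mat_of_cols (dim_row A) (map (lanczos_q A v) [1..<Suc m])"

text \<open>Matrix and vector indices start at 0, so the diagonal entry at \<open>i\<close> is \<open>\<alpha>\<^sub>i\<^sub>+\<^sub>1\<close> and the entries
  at \<open>(i, i + 1)\<close> and \<open>(i + 1, i)\<close> are \<open>\<beta>\<^sub>i\<^sub>+\<^sub>1\<close>.\<close>

definition lanczos_T :: "real mat \<Rightarrow> real vec \<Rightarrow> nat \<Rightarrow> real mat" where
  "lanczos_T A v m = mat m m (\<lambda>(i, j).
     if i = j then lanczos_alpha A v (Suc i)
     else if j = Suc i then lanczos_beta A v (Suc i)
     else if i = Suc j then lanczos_beta A v (Suc j)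
     else 0)"

text \<open>Admissible choices of \<open>q\<^sub>m\<^sub>+\<^sub>1\<close> after \<open>m\<close> steps: the vector computed by the iteration if
  \<open>\<beta>\<^sub>m \<noteq> 0\<close>, and an arbitrary unit vector orthogonal to the range of \<open>Q\<^sub>m\<close> if \<open>\<beta>\<^sub>m = 0\<close>.\<close>

definition lanczos_next :: "real mat \<Rightarrow> real vec \<Rightarrow> nat \<Rightarrow> real vec \<Rightarrow> bool" where
  "lanczos_next A v m q \<longleftrightarrow>
     (if lanczos_beta A v m \<noteq> 0 then q = lanczos_q A v (Suc m)
      else q \<in> carrier_vec (dim_row A) \<and> norm2 q = 1 \<and>
        (\<forall>x \<in> range_mat (lanczos_Q A v m). x \<bullet> q = 0))"

definition orth_complement_basis :: "real mat \<Rightarrow> real mat \<Rightarrow> bool" where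
  "orth_complement_basis Q Qp \<longleftrightarrow>
     Qp \<in> carrier_mat (dim_row Q) (dim_row Q - dim_col Q) \<and> orthonormal_cols Qp \<and>
     range_mat Qp = vec_module.orthogonal_complement (dim_row Q) (range_mat Q)"

definition off_diag_block :: "real mat \<Rightarrow> real mat \<Rightarrow> real mat \<Rightarrow> real mat" where
  "off_diag_block A Q Qp = transpose_mat Q * A * Qp"

end

theory Submission
  imports Defs
begin

text \<open>Read column by column, the three-term recurrence is the Lanczos relation; whatever the
  value of \<open>\<beta>\<^sub>m\<close>, its last residual is \<open>\<beta>\<^sub>m q\<^sub>m\<^sub>+\<^sub>1\<close>.  By symmetry of \<open>A\<close>, the entry \<open>(i, j)\<close>
  of the off-diagonal block is \<open>(A q\<^sub>i) \<bullet> p\<^sub>j\<close>, with \<open>p\<^sub>j\<close> the columns of the complement basis.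
  The relation and \<open>Q\<^sup>T p\<^sub>j = 0\<close> make it vanish for \<open>i < m\<close> and
  equal to \<open>\<beta>\<^sub>m (q\<^sub>m\<^sub>+\<^sub>1 \<bullet> p\<^sub>j) = \<beta>\<^sub>m (p\<^sub>1 \<bullet> p\<^sub>j)\<close> for \<open>i = m\<close>.\<close>

text \<open>This equation matches every \<beta> and would turn it into the norm of a residual; kept
  folded, \<beta> stays an atom shared by the recurrence and \<open>lanczos_T\<close>.\<close>

declare lanczos_beta.simps [simp del]

section \<open>Outer products: action on vectors, spectral norm, rank\<close>

lemma outer_prod_carrier:
  "u \<in> carrier_vec a \<Longrightarrow> w \<in> carrier_vec b \<Longrightarrow> outer_prod u w \<in> carrier_mat a b"
  by (simp add: outer_prod_def carrier_vecD)

lemma outer_prod_mult_vec: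
  assumes "dim_vec x = dim_vec w"
  shows "outer_prod u w *\<^sub>v x = (w \<bullet> x) \<cdot>\<^sub>v u"
  by (rule eq_vecI)
    (auto simp: outer_prod_def scalar_prod_def assms sum_distrib_left sum_distrib_right ac_simps
      intro!: sum.cong)

lemma scalar_prod_self_nonneg: "(x :: real vec) \<bullet> x \<ge> 0"
  by (simp add: scalar_prod_def sum_nonneg)

lemma norm2_eq_0:
  assumes "norm2 x = 0" "x \<in> carrier_vec n"
  shows "x = 0\<^sub>v n"
proof (rule eq_vecI)
  fix i assume i: "i < dim_vec (0\<^sub>v n :: real vec)"
  have "(\<Sum>i = 0..<n. x $ i * x $ i) = 0"
    using assms by (simp add: norm2_def scalar_prod_def)
  then have "x $ i * x $ i = 0"
    using i by (subst (asm) sum_nonneg_eq_0_iff) auto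
  with i show "x $ i = 0\<^sub>v n $ i" by simp
qed (use assms in simp)

lemma norm2_smult: "norm2 (c \<cdot>\<^sub>v x) = \<bar>c\<bar> * norm2 x"
proof -
  have "(c \<cdot>\<^sub>v x) \<bullet> (c \<cdot>\<^sub>v x) = c\<^sup>2 * (x \<bullet> x)"
    by (simp add: scalar_prod_def sum_distrib_left power2_eq_square ac_simps)
  then show ?thesis by (simp add: norm2_def real_sqrt_mult)
qed

lemma norm2_unit_vec: "i < n \<Longrightarrow> norm2 (unit_vec n i) = 1"
  by (simp add: norm2_def)

lemma abs_index_le_norm2:
  assumes "i < dim_vec x"
  shows "\<bar>x $ i\<bar> \<le> norm2 x"
proof -
  have "x $ i * x $ i \<le> (\<Sum>j = 0..<dim_vec x. x $ j * x $ j)"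
    using assms by (intro member_le_sum) auto
  then have "(x $ i)\<^sup>2 \<le> x \<bullet> x" by (simp add: scalar_prod_def power2_eq_square)
  then show ?thesis unfolding norm2_def by (intro real_le_rsqrt) simp
qed

text \<open>The matrix sends \<open>x\<close> to \<open>c * x $ j\<close> times a unit vector. On
  the unit ball \<open>x $ j\<close> is at most 1 in absolute value, with equality at
  \<open>unit_vec b j\<close>, so the supremum is a maximum.\<close>

lemma spectral_norm_unit_outer_prod:
  assumes "i < a" "j < b"
  shows "spectral_norm (c \<cdot>\<^sub>m outer_prod (unit_vec a i) (unit_vec b j)) = \<bar>c\<bar>" (is "spectral_norm ?M = _")
proof -
  have M: "outer_prod (unit_vec a i) (unit_vec b j) \<in> carrier_mat a b"
    by (intro outer_prod_carrier) auto
  have "norm2 (?M *\<^sub>v x) = \<bar>c\<bar> * \<bar>x $ j\<bar>" if "x \<in> carrier_vec b" for x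
  proof -
    have "?M *\<^sub>v x = c \<cdot>\<^sub>v (outer_prod (unit_vec a i) (unit_vec b j) *\<^sub>v x)"
      using M that by (intro eq_vecI) auto
    also have "\<dots> = c \<cdot>\<^sub>v (x $ j \<cdot>\<^sub>v unit_vec a i)"
      using that assms by (subst outer_prod_mult_vec) auto
    finally show ?thesis using assms by (simp add: norm2_smult norm2_unit_vec)
  qed
  note norm = this
  have dim: "dim_col ?M = b" using M by simp
  show ?thesis
    unfolding spectral_norm_def dim
  proof (rule cSup_eq_maximum)
    show "\<bar>c\<bar> \<in> (\<lambda>x. norm2 (?M *\<^sub>v x)) ` {x \<in> carrier_vec b. norm2 x \<le> 1}"
      using assms by (intro image_eqI[of _ _ "unit_vec b j"]) (auto simp: norm norm2_unit_vec)
  next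
    fix y assume "y \<in> (\<lambda>x. norm2 (?M *\<^sub>v x)) ` {x \<in> carrier_vec b. norm2 x \<le> 1}"
    then obtain x where x: "x \<in> carrier_vec b" "norm2 x \<le> 1" "y = \<bar>c\<bar> * \<bar>x $ j\<bar>"
      by (auto simp: norm)
    then have "\<bar>x $ j\<bar> \<le> 1" using abs_index_le_norm2[of j x] assms by auto
    then show "y \<le> \<bar>c\<bar>" using x by (simp add: mult_left_le)
  qed
qed

lemma rank_smult_outer_prod:
  assumes "u \<in> carrier_vec a" "w \<in> carrier_vec b"
  shows "vec_space.rank a (c \<cdot>\<^sub>m outer_prod u w) \<le> 1"
  by (rule vec_space.rank_le_1_product_entries[where f = "\<lambda>i. c * u $ i" and g = "\<lambda>j. w $ j"])
    (use assms in \<open>auto simp: outer_prod_def\<close>)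

section \<open>Column ranges and bases of the orthogonal complement\<close>

lemma mult_mat_unit_vec:
  fixes M :: "real mat"
  shows "M \<in> carrier_mat n k \<Longrightarrow> j < k \<Longrightarrow> M *\<^sub>v unit_vec k j = col M j"
  by (intro eq_vecI) auto

text \<open>Replaces the span of the columns by an image, so that membership in the range amounts to
  exhibiting a coefficient vector.\<close>

lemma range_mat_eq:
  assumes "M \<in> carrier_mat n k"
  shows "range_mat M = (\<lambda>x. M *\<^sub>v x) ` carrier_vec k"
  using assms vec_space.col_space_eq[OF assms] by (auto simp: range_mat_def)

lemma col_in_range_mat:
  assumes "M \<in> carrier_mat n k" "j < k"
  shows "col M j \<in> range_mat M"
  unfolding range_mat_eq[OF assms(1)]
  by (rule image_eqI[of _ _ "unit_vec k j"]) (simp_all add: mult_mat_unit_vec[OF assms])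

lemma orth_complement_basis_carrier:
  "Q \<in> carrier_mat d m \<Longrightarrow> orth_complement_basis Q P \<Longrightarrow> P \<in> carrier_mat d (d - m)"
  by (simp add: orth_complement_basis_def)

lemma orth_complement_basis_orthogonal:
  assumes "Q \<in> carrier_mat d m" "orth_complement_basis Q P" "y \<in> range_mat Q" "j < d - m"
  shows "y \<bullet> col P j = 0"
proof -
  have P: "P \<in> carrier_mat d (d - m)" using assms orth_complement_basis_carrier by blast
  have "col P j \<in> vec_module.orthogonal_complement d (range_mat Q)"
    using col_in_range_mat[OF P assms(4)] assms by (simp add: orth_complement_basis_def)
  then have "col P j \<bullet> y = 0" using assms(3) by (simp add: vec_module.orthogonal_complement_def)
  moreover have "y \<in> carrier_vec d" using assms(1,3) range_mat_eq[OF assms(1)] by auto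
  ultimately show ?thesis using P assms(4)
    by (simp add: comm_scalar_prod[of y d])
qed

lemma orthonormal_cols_scalar_prod:
  assumes "P \<in> carrier_mat n k" "orthonormal_cols P" "i < k" "j < k"
  shows "col P i \<bullet> col P j = (if i = j then 1 else 0)"
proof -
  have "(transpose_mat P * P) $$ (i, j) = (1\<^sub>m k :: real mat) $$ (i, j)"
    using assms by (simp add: orthonormal_cols_def)
  then show ?thesis using assms by simp
qed

section \<open>Lanczos vectors, residuals and the matrix relation\<close>

lemma lanczos_q_carrier:
  assumes "A \<in> carrier_mat d d" "v \<in> carrier_vec d"
  shows "lanczos_q A v k \<in> carrier_vec d"
proof -
  \<comment> \<open>Through the residual, the vector at \<open>Suc (Suc k)\<close> depends on those
    at \<open>Suc k\<close> and \<open>k\<close>, so the induction carries two consecutive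
    indices.\<close>
  have "lanczos_q A v k \<in> carrier_vec d \<and> lanczos_q A v (Suc k) \<in> carrier_vec d"
    by (induction k) (use assms in auto)
  then show ?thesis by simp
qed

lemma lanczos_residual_carrier:
  assumes "A \<in> carrier_mat d d" "v \<in> carrier_vec d"
  shows "lanczos_residual A v k \<in> carrier_vec d"
  by (cases k) (use assms lanczos_q_carrier[OF assms] in auto)

lemma lanczos_recurrence:
  assumes "A \<in> carrier_mat d d" "v \<in> carrier_vec d"
  shows "A *\<^sub>v lanczos_q A v (Suc k) = lanczos_alpha A v (Suc k) \<cdot>\<^sub>v lanczos_q A v (Suc k)
    + lanczos_beta A v k \<cdot>\<^sub>v lanczos_q A v k + lanczos_residual A v (Suc k)"
  using assms lanczos_q_carrier[OF assms, of k] lanczos_q_carrier[OF assms, of "Suc k"]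
  by (intro eq_vecI) (auto simp: lanczos_alpha_def)

text \<open>If \<beta> vanishes, so does the residual, and any admissible \<open>q\<close> fits;
  otherwise \<open>q\<close> is the normalized residual. Both cases of \<open>lanczos_next\<close>
  thus enter the matrix relation in the same way.\<close>

lemma lanczos_residual_next:
  assumes "A \<in> carrier_mat d d" "v \<in> carrier_vec d" "lanczos_next A v (Suc k) q"
  shows "lanczos_residual A v (Suc k) = lanczos_beta A v (Suc k) \<cdot>\<^sub>v q"
proof (cases "lanczos_beta A v (Suc k) = 0")
  case True
  then have "lanczos_residual A v (Suc k) = 0\<^sub>v d"
    by (intro norm2_eq_0 lanczos_residual_carrier assms) (simp add: lanczos_beta.simps)
  moreover have "q \<in> carrier_vec d" using assms True by (simp add: lanczos_next_def)
  ultimately show ?thesis using True by auto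
next
  case False
  then show ?thesis
    using assms(3) by (simp add: lanczos_next_def smult_smult_assoc)
qed

lemma lanczos_Q_carrier: "A \<in> carrier_mat d d \<Longrightarrow> lanczos_Q A v m \<in> carrier_mat d m"
  using mat_of_cols_carrier(1)[of "dim_row A" "map (lanczos_q A v) [1..<Suc m]"]
  by (simp add: lanczos_Q_def del: upt_Suc)

lemma lanczos_Q_index:
  assumes "A \<in> carrier_mat d d" "i < d" "j < m"
  shows "lanczos_Q A v m $$ (i, j) = lanczos_q A v (Suc j) $ i"
  using assms unfolding lanczos_Q_def
  by (subst mat_of_cols_index) (auto simp del: upt_Suc)

lemma col_lanczos_Q:
  assumes "A \<in> carrier_mat d d" "v \<in> carrier_vec d" "j < m"
  shows "col (lanczos_Q A v m) j = lanczos_q A v (Suc j)"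
  using assms lanczos_Q_carrier[OF assms(1), of v m] lanczos_q_carrier[OF assms(1,2), of "Suc j"]
  by (intro eq_vecI) (auto simp: lanczos_Q_index)

text \<open>Column \<open>j\<close> of the tridiagonal matrix has at most three nonzero entries; the
  first and last columns lack a neighbour. In the application, \<open>f\<close> is a row of
  \<open>lanczos_Q\<close>.\<close>

lemma sum_lanczos_T:
  fixes f :: "nat \<Rightarrow> real"
  assumes "j < m"
  shows "(\<Sum>k = 0..<m. f k * lanczos_T A v m $$ (k, j)) =
    lanczos_alpha A v (Suc j) * f j + (if j = 0 then 0 else lanczos_beta A v j * f (j - 1))
    + (if Suc j < m then lanczos_beta A v (Suc j) * f (Suc j) else 0)"
proof -
  have "(\<Sum>k = 0..<m. f k * lanczos_T A v m $$ (k, j)) =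
    (\<Sum>k = 0..<m. (if k = j then lanczos_alpha A v (Suc j) * f j else 0)
      + (if k = j - 1 then (if j = 0 then 0 else lanczos_beta A v j * f (j - 1)) else 0)
      + (if k = Suc j then lanczos_beta A v (Suc j) * f (Suc j) else 0))"
    using assms by (intro sum.cong) (auto simp: lanczos_T_def)
  also have "\<dots> = lanczos_alpha A v (Suc j) * f j
      + (if j = 0 then 0 else lanczos_beta A v j * f (j - 1))
      + (if Suc j < m then lanczos_beta A v (Suc j) * f (Suc j) else 0)"
    using assms by (simp add: sum.distrib)
  finally show ?thesis .
qed

text \<open>The residual of column \<open>j\<close> is the subdiagonal term of
  \<open>lanczos_T\<close> as long as \<open>Suc j < m\<close>; in the last column, where that entry
  does not exist, it becomes the rank-one term.\<close>

lemma lanczos_relation: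
  assumes A: "A \<in> carrier_mat d d" and v: "v \<in> carrier_vec d" and m: "1 \<le> m"
    and nb: "lanczos_no_breakdown A v m" and q: "lanczos_next A v m q" "q \<in> carrier_vec d"
  shows "A * lanczos_Q A v m = lanczos_Q A v m * lanczos_T A v m
    + lanczos_beta A v m \<cdot>\<^sub>m outer_prod q (unit_vec m (m - 1))" (is "A * ?Q = ?Q * ?T + ?R")
proof (rule eq_matI)
  have Q: "?Q \<in> carrier_mat d m" using A by (rule lanczos_Q_carrier)
  have T: "?T \<in> carrier_mat m m" by (simp add: lanczos_T_def)
  have R: "?R \<in> carrier_mat d m" using q by (intro smult_carrier_mat outer_prod_carrier) auto
  show "dim_row (A * ?Q) = dim_row (?Q * ?T + ?R)" "dim_col (A * ?Q) = dim_col (?Q * ?T + ?R)"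
    using A Q R by auto
  fix i j assume "i < dim_row (?Q * ?T + ?R)" "j < dim_col (?Q * ?T + ?R)"
  then have i: "i < d" and j: "j < m" using R by auto
  note qc = lanczos_q_carrier[OF A v]
  have "(A * ?Q) $$ (i, j) = (A *\<^sub>v lanczos_q A v (Suc j)) $ i"
    using A Q i j by (simp add: col_lanczos_Q[OF A v j])
  also have "\<dots> = lanczos_alpha A v (Suc j) * lanczos_q A v (Suc j) $ i
      + lanczos_beta A v j * lanczos_q A v j $ i + lanczos_residual A v (Suc j) $ i"
    using i qc[of j] qc[of "Suc j"] lanczos_residual_carrier[OF A v, of "Suc j"]
    by (simp add: lanczos_recurrence[OF A v] del: lanczos_residual.simps)
  \<comment> \<open>The convention \<open>q\<^sub>0 = 0\<close> removes this term in column 0, which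
    brings the sum into the shape of \<open>sum_lanczos_T\<close>.\<close>
  also have "lanczos_beta A v j * lanczos_q A v j $ i
      = (if j = 0 then 0 else lanczos_beta A v j * lanczos_q A v (Suc (j - 1)) $ i)"
    using A i by simp
  also have "lanczos_residual A v (Suc j) $ i
      = (if Suc j < m then lanczos_beta A v (Suc j) * lanczos_q A v (Suc (Suc j)) $ i else 0)
        + (if Suc j = m then lanczos_beta A v m * q $ i else 0)"
  proof (cases "Suc j = m")
    case True
    then show ?thesis using lanczos_residual_next[OF A v, of j q] q i by simp
  next
    case False
    then have "Suc j < m" using j by simp
    \<comment> \<open>Before step \<open>m\<close> there is no breakdown, so the vector computed by
      the iteration is itself the admissible one.\<close>
    moreover have "lanczos_next A v (Suc j) (lanczos_q A v (Suc (Suc j)))"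
      using nb \<open>Suc j < m\<close> by (simp add: lanczos_next_def lanczos_no_breakdown_def)
    from lanczos_residual_next[OF A v this]
    have "lanczos_residual A v (Suc j) = lanczos_beta A v (Suc j) \<cdot>\<^sub>v lanczos_q A v (Suc (Suc j))" .
    ultimately show ?thesis using i qc[of "Suc (Suc j)"]
      by (simp del: lanczos_residual.simps lanczos_q.simps)
  qed
  also have "(if Suc j = m then lanczos_beta A v m * q $ i else 0) = ?R $$ (i, j)"
    using i j q by (auto simp: outer_prod_def)
  finally have "(A * ?Q) $$ (i, j)
      = (\<Sum>k = 0..<m. lanczos_q A v (Suc k) $ i * ?T $$ (k, j)) + ?R $$ (i, j)"
    by (simp add: sum_lanczos_T[OF j] del: lanczos_q.simps)
  also have "(\<Sum>k = 0..<m. lanczos_q A v (Suc k) $ i * ?T $$ (k, j)) = (?Q * ?T) $$ (i, j)"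
    using Q T i j by (simp add: scalar_prod_def lanczos_Q_index[OF A])
  finally show "(A * ?Q) $$ (i, j) = (?Q * ?T + ?R) $$ (i, j)"
    using Q T i j carrier_matD[OF R] by (subst index_add_mat(1)) simp_all
qed

theorem lemma1:
  fixes A Q T Qperp Ax :: "real mat" and v q :: "real vec" and \<beta> :: real and d m :: nat
  assumes A: "sym_pos_def d A"
    and m: "1 \<le> m" "m < d"
    and v: "v \<in> carrier_vec d" "v \<noteq> 0\<^sub>v d"
    and no_breakdown: "lanczos_no_breakdown A v m"
    and Q: "Q = lanczos_Q A v m"
    and T: "T = lanczos_T A v m"
    and \<beta>: "\<beta> = lanczos_beta A v m"
    and q: "lanczos_next A v m q"
    and Qperp: "orth_complement_basis Q Qperp" "col Qperp 0 = q"
    and Ax: "Ax = off_diag_block A Q Qperp"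
  shows "(A * Q = Q * T + \<beta> \<cdot>\<^sub>m outer_prod q (unit_vec m (m - 1))) \<and>
      (vec_space.rank m Ax \<le> 1) \<and>
      (Ax = \<beta> \<cdot>\<^sub>m outer_prod (unit_vec m (m - 1)) (unit_vec (d - m) 0)) \<and>
      (spectral_norm Ax = \<beta>) \<and>
      (invariant_subspace A (range_mat Q) \<longleftrightarrow> Ax = 0\<^sub>m m (d - m)) \<and>
      (invariant_subspace A (range_mat Q) \<longleftrightarrow> \<beta> = 0)"
proof -
  have Ac: "A \<in> carrier_mat d d" and sym: "transpose_mat A = A"
    using A by (auto simp: sym_pos_def_def)
  have Qc: "Q \<in> carrier_mat d m" unfolding Q by (rule lanczos_Q_carrier[OF Ac])
  have Tc: "T \<in> carrier_mat m m" by (simp add: T lanczos_T_def)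
  have Pc: "Qperp \<in> carrier_mat d (d - m)" by (rule orth_complement_basis_carrier[OF Qc Qperp(1)])
  \<comment> \<open>The column with index 0 exists because \<open>m < d\<close>.\<close>
  have qc: "q \<in> carrier_vec d" using Pc m col_carrier_vec[of 0 "d - m" Qperp d] by (simp add: Qperp(2))
  let ?R = "\<beta> \<cdot>\<^sub>m outer_prod q (unit_vec m (m - 1))"
  have Rc: "?R \<in> carrier_mat d m" using qc by (intro smult_carrier_mat outer_prod_carrier) auto
  have rel: "A * Q = Q * T + ?R"
    unfolding Q T \<beta> by (rule lanczos_relation[OF Ac v(1) m(1) no_breakdown q qc])
  have q_orth: "q \<bullet> col Qperp j = (if j = 0 then 1 else 0)" if "j < d - m" for j
    using orthonormal_cols_scalar_prod[OF Pc _ _ that, of 0] Qperp m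
    by (auto simp: orth_complement_basis_def)
  have R_vec: "?R *\<^sub>v x = (\<beta> * x $ (m - 1)) \<cdot>\<^sub>v q" if "x \<in> carrier_vec m" for x
  proof -
    have "outer_prod q (unit_vec m (m - 1)) *\<^sub>v x = x $ (m - 1) \<cdot>\<^sub>v q"
      using that m by (subst outer_prod_mult_vec) auto
    moreover have "?R *\<^sub>v x = \<beta> \<cdot>\<^sub>v (outer_prod q (unit_vec m (m - 1)) *\<^sub>v x)"
      using Rc that by (intro eq_vecI) auto
    ultimately show ?thesis by (simp add: smult_smult_assoc)
  qed
  \<comment> \<open>The Lanczos relation applied to coefficients \<open>x\<close>: the image can
    leave the range of \<open>Q\<close> only along \<open>q\<close>, in proportion to the last
    coordinate.\<close>
  have AQ_vec: "A *\<^sub>v (Q *\<^sub>v x) = Q *\<^sub>v (T *\<^sub>v x) + (\<beta> * x $ (m - 1)) \<cdot>\<^sub>v q"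
    if x: "x \<in> carrier_vec m" for x
  proof -
    have "A *\<^sub>v (Q *\<^sub>v x) = (A * Q) *\<^sub>v x" using Ac Qc x by simp
    also have "\<dots> = (Q * T) *\<^sub>v x + ?R *\<^sub>v x"
      unfolding rel using Qc Tc Rc x by (intro add_mult_distrib_mat_vec) auto
    also have "(Q * T) *\<^sub>v x = Q *\<^sub>v (T *\<^sub>v x)" using Qc Tc x by simp
    finally show ?thesis unfolding R_vec[OF x] .
  qed
  have Q_range: "Q *\<^sub>v x \<in> range_mat Q" if "x \<in> carrier_vec m" for x
    using that by (simp add: range_mat_eq[OF Qc])
  \<comment> \<open>This yields the entries of the block at \<open>x = unit_vec m i\<close>, and the
    failure of invariance for nonzero \<beta> at \<open>x = unit_vec m (m - 1)\<close>.\<close>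
  have AQ_prod: "(A *\<^sub>v (Q *\<^sub>v x)) \<bullet> col Qperp j = (if j = 0 then \<beta> * x $ (m - 1) else 0)"
    if x: "x \<in> carrier_vec m" and j: "j < d - m" for x j
  proof -
    have "Q *\<^sub>v (T *\<^sub>v x) \<in> carrier_vec d" "col Qperp j \<in> carrier_vec d"
      using Qc Tc Pc x j by auto
    then have "(A *\<^sub>v (Q *\<^sub>v x)) \<bullet> col Qperp j
        = (Q *\<^sub>v (T *\<^sub>v x)) \<bullet> col Qperp j + (\<beta> * x $ (m - 1)) * (q \<bullet> col Qperp j)"
      unfolding AQ_vec[OF x] using qc by (subst add_scalar_prod_distrib[of _ d]) auto
    then show ?thesis
      using orth_complement_basis_orthogonal[OF Qc Qperp(1) Q_range j] Tc x q_orth[OF j] by simp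
  qed

  have Ax_eq: "Ax = \<beta> \<cdot>\<^sub>m outer_prod (unit_vec m (m - 1)) (unit_vec (d - m) 0)" (is "_ = ?B")
  proof (rule eq_matI)
    show "dim_row Ax = dim_row ?B" "dim_col Ax = dim_col ?B"
      using Qc Pc by (auto simp: Ax off_diag_block_def outer_prod_def)
    fix i j assume "i < dim_row ?B" "j < dim_col ?B"
    then have i: "i < m" and j: "j < d - m" by (auto simp: outer_prod_def)
    have "transpose_mat Q * A = transpose_mat (A * Q)"
      using transpose_mult[OF Ac Qc] sym by simp
    then have "Ax $$ (i, j) = col (A * Q) i \<bullet> col Qperp j"
      using Ac Qc Pc i j by (simp add: Ax off_diag_block_def)
    also have "col (A * Q) i = A *\<^sub>v (Q *\<^sub>v unit_vec m i)"
      using Ac Qc i by (simp only: mult_mat_unit_vec col_mult2)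
    also have "\<dots> \<bullet> col Qperp j = ?B $$ (i, j)"
      using i j m by (subst AQ_prod) (auto simp: outer_prod_def)
    finally show "Ax $$ (i, j) = ?B $$ (i, j)" .
  qed

  have rank: "vec_space.rank m Ax \<le> 1"
    unfolding Ax_eq by (rule rank_smult_outer_prod[OF unit_vec_carrier unit_vec_carrier])
  \<comment> \<open>Needed to drop the absolute value in the spectral norm of the rank-one
    matrix.\<close>
  have "\<beta> \<ge> 0" by (simp add: \<beta> lanczos_beta.simps norm2_def scalar_prod_self_nonneg)
  then have norm: "spectral_norm Ax = \<beta>"
    unfolding Ax_eq using m by (subst spectral_norm_unit_outer_prod) auto
  have Ax_0: "Ax = 0\<^sub>m m (d - m) \<longleftrightarrow> \<beta> = 0"
  proof
    assume "Ax = 0\<^sub>m m (d - m)"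
    \<comment> \<open>The only position where the block can be nonzero; its entry there is
      \<beta>.\<close>
    then have "Ax $$ (m - 1, 0) = 0" using m by simp
    then show "\<beta> = 0" using m by (simp add: Ax_eq outer_prod_def)
  qed (auto simp: Ax_eq outer_prod_def)
  have inv: "invariant_subspace A (range_mat Q) \<longleftrightarrow> \<beta> = 0"
  proof
    \<comment> \<open>\<open>Q *\<^sub>v ?e\<close> is the last Lanczos vector, the only basis
      vector whose image can leave the range; pairing that image with \<open>q\<close> isolates
      \<beta>.\<close>
    let ?e = "unit_vec m (m - 1) :: real vec"
    assume "invariant_subspace A (range_mat Q)"
    then have "A *\<^sub>v (Q *\<^sub>v ?e) \<in> range_mat Q"
      using Q_range by (simp add: invariant_subspace_def)
    then have "(A *\<^sub>v (Q *\<^sub>v ?e)) \<bullet> col Qperp 0 = 0"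
      using orth_complement_basis_orthogonal[OF Qc Qperp(1)] m by simp
    then show "\<beta> = 0" using AQ_prod[of ?e 0] m by simp
  next
    assume "\<beta> = 0"
    \<comment> \<open>The image of a range vector with coefficients \<open>x\<close> is again in the
      range, with coefficients \<open>T *\<^sub>v x\<close>.\<close>
    then have "A *\<^sub>v (Q *\<^sub>v x) = Q *\<^sub>v (T *\<^sub>v x)" if "x \<in> carrier_vec m" for x
      using AQ_vec[OF that] Qc Tc qc that by (auto intro!: eq_vecI)
    then show "invariant_subspace A (range_mat Q)"
      using Tc by (auto simp: invariant_subspace_def range_mat_eq[OF Qc])
  qed
  show ?thesis using rel rank Ax_eq norm Ax_0 inv by blast
qed

end
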